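(* If the full subcategory $\mathsf{CExt}\,\mathsf{Rck}$ of central extensions of racks is reflective in the category of extensions $\mathsf{Ext}\,\mathsf{Rck}$, then also $\mathsf{CExt}\,\mathsf{Qnd}$ is reflective in $\mathsf{Ext}\,\mathsf{Qnd}$, and the reflection is computed as in $\mathsf{Ext}\,\mathsf{Rck}$, via the inclusion $\mathrm I\colon\mathsf{Qnd}\to\mathsf{Rck}$.
   Context: A rack is a set $X$ with two binary operations $\triangleleft,\triangleleft^{-1}$ such that $(x\triangleleft y)\triangleleft^{-1}y = x = (x\triangleleft^{-1}y)\triangleleft y$ and $(x\triangleleft y)\triangleleft z=(x\triangleleft z)\triangleleft(y\triangleleft z)$; a quandle is a rack with $x\triangleleft x=x$. $\mathsf{Rck}$ and $\mathsf{Qnd}$ are the categories of racks and quandles. Let $\mathsf C$ be $\mathsf{Rck}$ or $\mathsf{Qnd}$. An extension in $\mathsf C$ is a surjective morphism. $\mathsf{Ext}\,\mathsf C$ has extensions as objects and commutative squares as morphisms. $\pi_0(X)$ is the quotient of the set $X$ by the equivalence relation generated by the pairs $(x,x\triangleleft y)$, with quotient map $\eta_X$; an extension $t\colon X\to Y$ in $\mathsf C$ is trivial if the square $\eta_Yt=\pi_0(t)\eta_X$ is a pullback (sets being viewed as objects with $x\triangleleft y=x$); an extension $f\colon A\to B$ in $\mathsf C$ is central if its pullback along some extension $E\to B$ of $\mathsf C$ is trivial. $\mathsf{CExt}\,\mathsf C$ is the full subcategory of $\mathsf{Ext}\,\mathsf C$ on central extensions. *)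

theory Defs
  imports "HOL-Library.FuncSet" "HOL-Library.Equipollence"
begin

section \<open>Racks and quandles\<close>

record 'a rack =
  carr :: "'a set"
  rop  :: "'a \<Rightarrow> 'a \<Rightarrow> 'a"
  rinv :: "'a \<Rightarrow> 'a \<Rightarrow> 'a"

definition is_rack :: "'a rack \<Rightarrow> bool" where
  "is_rack X \<longleftrightarrow>
     (\<forall>x\<in>carr X. \<forall>y\<in>carr X. rop X x y \<in> carr X \<and> rinv X x y \<in> carr X) \<and>
     (\<forall>x\<in>carr X. \<forall>y\<in>carr X. rinv X (rop X x y) y = x \<and> rop X (rinv X x y) y = x) \<and>
     (\<forall>x\<in>carr X. \<forall>y\<in>carr X. \<forall>z\<in>carr X.
        rop X (rop X x y) z = rop X (rop X x z) (rop X y z))"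

definition is_quandle :: "'a rack \<Rightarrow> bool" where
  "is_quandle X \<longleftrightarrow> is_rack X \<and> (\<forall>x\<in>carr X. rop X x x = x)"

text \<open>Morphisms are undefined outside the carrier of their domain, so that equality of
  morphisms is equality in HOL.\<close>

definition rack_hom :: "'a rack \<Rightarrow> 'b rack \<Rightarrow> ('a \<Rightarrow> 'b) set" where
  "rack_hom X Y = {h \<in> carr X \<rightarrow>\<^sub>E carr Y.
     \<forall>x\<in>carr X. \<forall>y\<in>carr X. h (rop X x y) = rop Y (h x) (h y) \<and> h (rinv X x y) = rinv Y (h x) (h y)}"

text \<open>A set as a rack (in fact a quandle).\<close>

definition trivial_rack :: "'a set \<Rightarrow> 'a rack" where
  "trivial_rack S = \<lparr>carr = S, rop = (\<lambda>x y. x), rinv = (\<lambda>x y. x)\<rparr>"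


section \<open>Pullbacks\<close>

definition fiber_product :: "'a rack \<Rightarrow> ('a \<Rightarrow> 'c) \<Rightarrow> 'b rack \<Rightarrow> ('b \<Rightarrow> 'c) \<Rightarrow> ('a \<times> 'b) rack" where
  "fiber_product X f Y g = \<lparr>carr = {(x, y). x \<in> carr X \<and> y \<in> carr Y \<and> f x = g y},
     rop = (\<lambda>(x, y) (x', y'). (rop X x x', rop Y y y')),
     rinv = (\<lambda>(x, y) (x', y'). (rinv X x x', rinv Y y y'))\<rparr>"

text \<open>The commutative square with projections \<open>p\<close>, \<open>q\<close> over \<open>f\<close>, \<open>g\<close> is a pullback if the
  comparison morphism to the fibre product is an isomorphism. The lemma
  \<open>is_pullback_universal\<close> gives the universal property, for test racks over any type.\<close>

definition is_pullback ::
  "'p rack \<Rightarrow> ('p \<Rightarrow> 'a) \<Rightarrow> ('p \<Rightarrow> 'b) \<Rightarrow> 'a rack \<Rightarrow> ('a \<Rightarrow> 'c) \<Rightarrow> 'b rack \<Rightarrow> ('b \<Rightarrow> 'c) \<Rightarrow> bool" where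
  "is_pullback P p q X f Y g \<longleftrightarrow>
     p \<in> rack_hom P X \<and> q \<in> rack_hom P Y \<and> (\<forall>z\<in>carr P. f (p z) = g (q z)) \<and>
     bij_betw (\<lambda>z. (p z, q z)) (carr P) (carr (fiber_product X f Y g))"

lemma is_pullback_universal:
  assumes pb: "is_pullback P p q X f Y g" and racks: "is_rack Z" "is_rack P"
    and a: "a \<in> rack_hom Z X" and b: "b \<in> rack_hom Z Y"
    and ab: "\<And>z. z \<in> carr Z \<Longrightarrow> f (a z) = g (b z)"
  shows "\<exists>!h. h \<in> rack_hom Z P \<and> (\<forall>z\<in>carr Z. p (h z) = a z \<and> q (h z) = b z)"
proof -
  have p: "p \<in> rack_hom P X" and q: "q \<in> rack_hom P Y"
    and bij: "bij_betw (\<lambda>z. (p z, q z)) (carr P) (carr (fiber_product X f Y g))"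
    using pb by (auto simp: is_pullback_def)
  have inj: "w = w'" if "w \<in> carr P" "w' \<in> carr P" "p w = p w'" "q w = q w'" for w w'
    using bij that by (auto simp: bij_betw_def inj_on_def)
  have ex: "\<exists>w. w \<in> carr P \<and> p w = a z \<and> q w = b z" if z: "z \<in> carr Z" for z
  proof -
    have "(a z, b z) \<in> carr (fiber_product X f Y g)"
      using z a b ab by (auto simp: fiber_product_def rack_hom_def)
    then have "(a z, b z) \<in> (\<lambda>z. (p z, q z)) ` carr P" using bij by (simp add: bij_betw_def)
    then show ?thesis by auto
  qed
  define h where "h = (\<lambda>z\<in>carr Z. SOME w. w \<in> carr P \<and> p w = a z \<and> q w = b z)"
  have h: "h z \<in> carr P" "p (h z) = a z" "q (h z) = b z" if "z \<in> carr Z" for z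
    using someI_ex[OF ex[OF that]] that by (auto simp: h_def)
  have cl: "rop Z x y \<in> carr Z" "rinv Z x y \<in> carr Z" if "x \<in> carr Z" "y \<in> carr Z" for x y
    using racks that by (auto simp: is_rack_def)
  have clP: "rop P x y \<in> carr P" "rinv P x y \<in> carr P" if "x \<in> carr P" "y \<in> carr P" for x y
    using racks that by (auto simp: is_rack_def)
  have "h \<in> rack_hom Z P"
    unfolding rack_hom_def
  proof (intro CollectI conjI ballI)
    show "h \<in> carr Z \<rightarrow>\<^sub>E carr P" using h by (auto simp: h_def)
  next
    fix x y assume xy: "x \<in> carr Z" "y \<in> carr Z"
    show "h (rop Z x y) = rop P (h x) (h y)"
      by (rule inj) (use xy h cl clP p q a b in \<open>simp_all add: rack_hom_def\<close>)
    show "h (rinv Z x y) = rinv P (h x) (h y)"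
      by (rule inj) (use xy h cl clP p q a b in \<open>simp_all add: rack_hom_def\<close>)
  qed
  moreover have "k = h" if k: "k \<in> rack_hom Z P" "\<forall>z\<in>carr Z. p (k z) = a z \<and> q (k z) = b z" for k
  proof (rule extensionalityI[where A = "carr Z"])
    show "k \<in> extensional (carr Z)" using k by (auto simp: rack_hom_def PiE_def)
    show "h \<in> extensional (carr Z)" by (simp add: h_def)
    fix z assume "z \<in> carr Z"
    with k h show "k z = h z" by (intro inj) (auto simp: rack_hom_def)
  qed
  ultimately show ?thesis using h by blast
qed


section \<open>Connected components\<close>

definition conn :: "'a rack \<Rightarrow> 'a rel" where
  "conn X = {(x, y). x \<in> carr X \<and> y \<in> carr X \<and>
     equivclp (\<lambda>a b. a \<in> carr X \<and> (\<exists>c\<in>carr X. b = rop X a c)) x y}"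

definition pi0 :: "'a rack \<Rightarrow> 'a set rack" where
  "pi0 X = trivial_rack (carr X // conn X)"

definition eta :: "'a rack \<Rightarrow> 'a \<Rightarrow> 'a set" where
  "eta X = (\<lambda>x\<in>carr X. conn X `` {x})"

text \<open>For a morphism \<open>t\<close>, all elements of a class \<open>c\<close> are sent by \<open>t\<close> into one class of \<open>Y\<close>,
  which is thus the saturation of \<open>t ` c\<close>; see \<open>pi0_map_eta\<close>.\<close>

definition pi0_map :: "'a rack \<Rightarrow> 'b rack \<Rightarrow> ('a \<Rightarrow> 'b) \<Rightarrow> 'a set \<Rightarrow> 'b set" where
  "pi0_map X Y t = (\<lambda>c\<in>carr (pi0 X). conn Y `` (t ` c))"

lemma equiv_conn: "equiv (carr X) (conn X)"
  by (auto simp: equiv_def refl_on_def sym_def trans_def conn_def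
      intro: equivclp_sym equivclp_trans)

lemma conn_map:
  assumes t: "t \<in> rack_hom X Y" and xy: "(x, y) \<in> conn X"
  shows "(t x, t y) \<in> conn Y"
proof -
  let ?R = "\<lambda>Z a b. a \<in> carr Z \<and> (\<exists>c\<in>carr Z. b = rop Z a c)"
  have "equivclp (?R X) x y" using xy by (simp add: conn_def)
  then have "equivclp (?R Y) (t x) (t y)"
  proof (induction rule: equivclp_induct)
    case base
    show ?case by simp
  next
    case (step y z)
    then have "?R Y (t y) (t z) \<or> ?R Y (t z) (t y)"
      using t by (auto simp: rack_hom_def)
    then have "equivclp (?R Y) (t y) (t z)"
      by (auto intro: equivclp_sym)
    with step.IH show ?case by (rule equivclp_trans)
  qed
  with t xy show ?thesis by (auto simp: conn_def rack_hom_def)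
qed

lemma pi0_map_eta:
  assumes t: "t \<in> rack_hom X Y" and x: "x \<in> carr X"
  shows "pi0_map X Y t (eta X x) = eta Y (t x)"
proof -
  have "t x \<in> carr Y" using t x by (auto simp: rack_hom_def)
  moreover have "conn Y `` (t ` (conn X `` {x})) = conn Y `` {t x}"
  proof (intro equalityI subsetI)
    fix z assume "z \<in> conn Y `` (t ` (conn X `` {x}))"
    then obtain y where "(x, y) \<in> conn X" "(t y, z) \<in> conn Y" by blast
    with conn_map[OF t] have "(t x, z) \<in> conn Y"
      by (meson equiv_conn equivE transD)
    then show "z \<in> conn Y `` {t x}" by blast
  next
    fix z assume "z \<in> conn Y `` {t x}"
    moreover have "(x, x) \<in> conn X" using x by (simp add: conn_def)
    ultimately show "z \<in> conn Y `` (t ` (conn X `` {x}))" by blast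
  qed
  ultimately show ?thesis
    using x by (simp add: pi0_map_def eta_def pi0_def trivial_rack_def quotientI)
qed


section \<open>Categories and reflective subcategories\<close>

text \<open>Composition \<open>cmp C x g f\<close>, for \<open>f\<close> with domain \<open>x\<close>, takes the domain as an argument
  because arrows need not determine it.\<close>

record ('o, 'm) category =
  obj :: "'o set"
  hom :: "'o \<Rightarrow> 'o \<Rightarrow> 'm set"
  cmp :: "'o \<Rightarrow> 'm \<Rightarrow> 'm \<Rightarrow> 'm"
  idm :: "'o \<Rightarrow> 'm"

definition is_category :: "('o, 'm) category \<Rightarrow> bool" where
  "is_category C \<longleftrightarrow>
     (\<forall>x\<in>obj C. idm C x \<in> hom C x x) \<and>
     (\<forall>x\<in>obj C. \<forall>y\<in>obj C. \<forall>z\<in>obj C. \<forall>f\<in>hom C x y. \<forall>g\<in>hom C y z. cmp C x g f \<in> hom C x z) \<and>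
     (\<forall>x\<in>obj C. \<forall>y\<in>obj C. \<forall>f\<in>hom C x y. cmp C x f (idm C x) = f \<and> cmp C x (idm C y) f = f) \<and>
     (\<forall>w\<in>obj C. \<forall>x\<in>obj C. \<forall>y\<in>obj C. \<forall>z\<in>obj C. \<forall>f\<in>hom C w x. \<forall>g\<in>hom C x y. \<forall>h\<in>hom C y z.
        cmp C w h (cmp C w g f) = cmp C w (cmp C x h g) f)"

definition full_subcategory :: "('o, 'm) category \<Rightarrow> ('o, 'm) category \<Rightarrow> bool" where
  "full_subcategory D C \<longleftrightarrow> obj D \<subseteq> obj C \<and> D = C\<lparr>obj := obj D\<rparr>"

definition is_functor ::
  "('o, 'm) category \<Rightarrow> ('p, 'n) category \<Rightarrow> ('o \<Rightarrow> 'p) \<Rightarrow> ('o \<Rightarrow> 'o \<Rightarrow> 'm \<Rightarrow> 'n) \<Rightarrow> bool" where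
  "is_functor C D F\<^sub>0 F\<^sub>1 \<longleftrightarrow>
     (\<forall>x\<in>obj C. F\<^sub>0 x \<in> obj D \<and> F\<^sub>1 x x (idm C x) = idm D (F\<^sub>0 x)) \<and>
     (\<forall>x\<in>obj C. \<forall>y\<in>obj C. \<forall>f\<in>hom C x y. F\<^sub>1 x y f \<in> hom D (F\<^sub>0 x) (F\<^sub>0 y)) \<and>
     (\<forall>x\<in>obj C. \<forall>y\<in>obj C. \<forall>z\<in>obj C. \<forall>f\<in>hom C x y. \<forall>g\<in>hom C y z.
        F\<^sub>1 x z (cmp C x g f) = cmp D (F\<^sub>0 x) (F\<^sub>1 y z g) (F\<^sub>1 x y f))"

text \<open>\<open>(F\<^sub>0, F\<^sub>1)\<close> is left adjoint to the inclusion of the full subcategory \<open>D\<close> of \<open>C\<close>, with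
  unit \<open>u\<close>.\<close>

definition is_reflector ::
  "('o, 'm) category \<Rightarrow> ('o, 'm) category \<Rightarrow> ('o \<Rightarrow> 'o) \<Rightarrow> ('o \<Rightarrow> 'o \<Rightarrow> 'm \<Rightarrow> 'm) \<Rightarrow> ('o \<Rightarrow> 'm) \<Rightarrow> bool" where
  "is_reflector D C F\<^sub>0 F\<^sub>1 u \<longleftrightarrow>
     full_subcategory D C \<and> is_functor C D F\<^sub>0 F\<^sub>1 \<and>
     (\<forall>x\<in>obj C. u x \<in> hom C x (F\<^sub>0 x)) \<and>
     (\<forall>x\<in>obj C. \<forall>y\<in>obj C. \<forall>f\<in>hom C x y. cmp C x (u y) f = cmp C x (F\<^sub>1 x y f) (u x)) \<and>
     (\<forall>x\<in>obj C. \<forall>d\<in>obj D. \<forall>f\<in>hom C x d. \<exists>!g. g \<in> hom D (F\<^sub>0 x) d \<and> cmp C x g (u x) = f)"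

definition reflective :: "('o, 'm) category \<Rightarrow> ('o, 'm) category \<Rightarrow> bool" where
  "reflective D C \<longleftrightarrow> (\<exists>F\<^sub>0 F\<^sub>1 u. is_reflector D C F\<^sub>0 F\<^sub>1 u)"


section \<open>Extensions, trivial and central extensions\<close>

text \<open>A notion of smallness for subsets of \<open>'u\<close>: it depends on cardinality only and admits an
  infinite set. The small sets are thus those of cardinality at most (or less than) some given
  cardinal; all subsets of an infinite type, or the sets of cardinality below an inaccessible,
  are instances.\<close>

definition smallness :: "'u set set \<Rightarrow> bool" where
  "smallness U \<longleftrightarrow> (\<forall>X\<in>U. \<forall>Y. Y \<lesssim> X \<longrightarrow> Y \<in> U) \<and> (\<exists>X\<in>U. infinite X)"

text \<open>The categories \<open>Rck\<close> and \<open>Qnd\<close> of small racks and quandles are given by their objects;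
  their morphisms are those of \<open>rack_hom\<close>, and the inclusion of \<open>Qnd\<close> in \<open>Rck\<close> is the inclusion
  of sets.\<close>

definition Rck :: "'u set set \<Rightarrow> 'u rack set" where
  "Rck U = {X. is_rack X \<and> carr X \<in> U}"

definition Qnd :: "'u set set \<Rightarrow> 'u rack set" where
  "Qnd U = {X. is_quandle X \<and> carr X \<in> U}"

lemma Qnd_subset_Rck: "Qnd U \<subseteq> Rck U"
  by (auto simp: Qnd_def Rck_def is_quandle_def)

record ('a, 'b) rack_arrow =
  src :: "'a rack"
  tgt :: "'b rack"
  fn  :: "'a \<Rightarrow> 'b"

definition is_extension :: "('a, 'b) rack_arrow \<Rightarrow> bool" where
  "is_extension f \<longleftrightarrow> fn f \<in> rack_hom (src f) (tgt f) \<and> fn f ` carr (src f) = carr (tgt f)"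

definition Ext :: "'u rack set \<Rightarrow> (('u, 'u) rack_arrow, ('u \<Rightarrow> 'u) \<times> ('u \<Rightarrow> 'u)) category" where
  "Ext C = \<lparr>
     obj = {f. src f \<in> C \<and> tgt f \<in> C \<and> is_extension f},
     hom = (\<lambda>f g. {(s, t). s \<in> rack_hom (src f) (src g) \<and> t \<in> rack_hom (tgt f) (tgt g) \<and>
                           (\<forall>x\<in>carr (src f). fn g (s x) = t (fn f x))}),
     cmp = (\<lambda>f (s', t') (s, t). (compose (carr (src f)) s' s, compose (carr (tgt f)) t' t)),
     idm = (\<lambda>f. (\<lambda>x\<in>carr (src f). x, \<lambda>y\<in>carr (tgt f). y))\<rparr>"

definition trivial_extension :: "('a, 'b) rack_arrow \<Rightarrow> bool" where
  "trivial_extension t \<longleftrightarrow> is_extension t \<and>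
     is_pullback (src t) (fn t) (eta (src t))
       (tgt t) (eta (tgt t)) (pi0 (src t)) (pi0_map (src t) (tgt t) (fn t))"

text \<open>The pullback of \<open>f : A \<rightarrow> B\<close> along \<open>e : E \<rightarrow> B\<close>, as an extension of \<open>E\<close>. Its domain is a
  rack on pairs; for \<open>A\<close> and \<open>E\<close> in \<open>Rck U\<close> or \<open>Qnd U\<close>, it is isomorphic to an object
  of the same category.\<close>

definition pullback_ext ::
  "('a, 'c) rack_arrow \<Rightarrow> ('b, 'c) rack_arrow \<Rightarrow> ('a \<times> 'b, 'b) rack_arrow" where
  "pullback_ext f e = (let P = fiber_product (src f) (fn f) (src e) (fn e)
     in \<lparr>src = P, tgt = src e, fn = restrict snd (carr P)\<rparr>)"

definition is_central :: "'u rack set \<Rightarrow> ('u, 'u) rack_arrow \<Rightarrow> bool" where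
  "is_central C f \<longleftrightarrow> f \<in> obj (Ext C) \<and>
     (\<exists>e\<in>obj (Ext C). tgt e = tgt f \<and> trivial_extension (pullback_ext f e))"

definition CExt :: "'u rack set \<Rightarrow> (('u, 'u) rack_arrow, ('u \<Rightarrow> 'u) \<times> ('u \<Rightarrow> 'u)) category" where
  "CExt C = (Ext C)\<lparr>obj := {f. is_central C f}\<rparr>"

lemma full_subcategory_CExt: "full_subcategory (CExt C) (Ext C)"
  by (auto simp: full_subcategory_def CExt_def is_central_def)

lemma rack_hom_compose:
  assumes "s \<in> rack_hom X Y" "t \<in> rack_hom Y Z" "is_rack X"
  shows "compose (carr X) t s \<in> rack_hom X Z"
  using assms by (auto simp: rack_hom_def is_rack_def compose_def PiE_def Pi_def)

lemma rack_hom_id: "is_rack X \<Longrightarrow> (\<lambda>x\<in>carr X. x) \<in> rack_hom X X"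
  by (auto simp: rack_hom_def is_rack_def)

lemma rack_hom_compose_id:
  assumes "s \<in> rack_hom X Y"
  shows "compose (carr X) s (\<lambda>x\<in>carr X. x) = s" "compose (carr X) (\<lambda>y\<in>carr Y. y) s = s"
  using assms by (auto simp: rack_hom_def compose_def PiE_def extensional_def Pi_def fun_eq_iff)

lemma rack_hom_compose_assoc:
  assumes "s \<in> rack_hom X Y"
  shows "compose (carr X) v (compose (carr X) t s) = compose (carr X) (compose (carr Y) v t) s"
  using assms by (auto simp: rack_hom_def compose_def fun_eq_iff)

lemma is_category_Ext:
  assumes "C \<subseteq> {X. is_rack X}"
  shows "is_category (Ext C)"
  unfolding is_category_def
proof (intro conjI ballI)
  fix x assume "x \<in> obj (Ext C)"
  with assms show "idm (Ext C) x \<in> hom (Ext C) x x"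
    by (auto simp: Ext_def is_extension_def rack_hom_id)
next
  fix x y z f g
  assume "x \<in> obj (Ext C)" "y \<in> obj (Ext C)" "z \<in> obj (Ext C)"
    "f \<in> hom (Ext C) x y" "g \<in> hom (Ext C) y z"
  moreover from this assms have "fn x w \<in> carr (tgt x)" if "w \<in> carr (src x)" for w
    using that by (auto simp: Ext_def is_extension_def)
  moreover from calculation have "fst f w \<in> carr (src y)" if "w \<in> carr (src x)" for w
    using that by (auto simp: Ext_def rack_hom_def)
  ultimately show "cmp (Ext C) x g f \<in> hom (Ext C) x z"
    using assms by (auto simp: Ext_def is_extension_def compose_eq intro!: rack_hom_compose)
next
  fix x y f assume "f \<in> hom (Ext C) x y"
  then show "cmp (Ext C) x f (idm (Ext C) x) = f" "cmp (Ext C) x (idm (Ext C) y) f = f"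
    by (auto simp: Ext_def rack_hom_compose_id)
next
  fix w x y z f g h
  assume "f \<in> hom (Ext C) w x" "g \<in> hom (Ext C) x y" "h \<in> hom (Ext C) y z"
  then show "cmp (Ext C) w h (cmp (Ext C) w g f) = cmp (Ext C) w (cmp (Ext C) x h g) f"
    by (auto simp: Ext_def rack_hom_compose_assoc)
qed

end

theory Submission
  imports Defs
begin

text \<open>The reflection of an extension of quandles, formed among racks, is again a central extension
  of quandles. Everything else is immediate, because \<open>Qnd\<close> is full in \<open>Rck\<close>.

  Centrality is compared with an elementary condition: a \<^emph>\<open>covering\<close> is an extension \<open>f\<close> for which
  \<open>f a = f a'\<close> implies that \<open>a\<close> and \<open>a'\<close> act in the same way. Central extensions of racks are
  coverings (\<open>central_imp_covering\<close>). Conversely, a covering \<open>f : A \<rightarrow> B\<close> of quandles is central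
  even in \<open>Qnd\<close> (\<open>covering_imp_central\<close>). For this it suffices to find an extension \<open>e : E \<rightarrow> B\<close> of
  quandles that lifts through \<open>f\<close> so often that each point of the pullback of \<open>f\<close> along \<open>e\<close> is
  on the graph of a lift \<open>E \<rightarrow> A\<close> (\<open>trivial_pullback_of_lifts\<close>). The enumerations of the fibres
  of \<open>f\<close>, under pointwise operations, form such an \<open>E\<close>, the lifts being the evaluations. A
  subquandle generated by few enumerations suffices, and it is small because a set generated under
  two operations has no more elements than any infinite set at least as large as the set of
  generators (\<open>small_closure\<close>).

  Let \<open>f\<close> now be an extension of quandles with reflection \<open>F\<^sub>0 f\<close> among racks. The image of the unit
  \<open>f \<rightarrow> F\<^sub>0 f\<close> is an extension of quandles, and it is a covering because the condition passes to
  subextensions. Hence it is central. By the universal property a central subextension of \<open>F\<^sub>0 f\<close>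
  that contains the image of the unit is all of \<open>F\<^sub>0 f\<close>, so \<open>F\<^sub>0 f\<close> is a covering of quandles and
  therefore central in \<open>Qnd\<close> (\<open>reflection_quandle\<close>).\<close>

section \<open>Elementary facts on racks and their components\<close>

lemma rack_closed:
  assumes "is_rack X" "x \<in> carr X" "y \<in> carr X"
  shows "rop X x y \<in> carr X" "rinv X x y \<in> carr X"
  using assms by (auto simp: is_rack_def)

lemma rack_cancel:
  assumes "is_rack X" "x \<in> carr X" "y \<in> carr X"
  shows "rinv X (rop X x y) y = x" "rop X (rinv X x y) y = x"
  using assms by (auto simp: is_rack_def)

lemma rack_distrib:
  assumes "is_rack X" "x \<in> carr X" "y \<in> carr X" "z \<in> carr X"
  shows "rop X (rop X x y) z = rop X (rop X x z) (rop X y z)"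
  using assms unfolding is_rack_def by blast

lemma rack_homD:
  assumes "h \<in> rack_hom X Y" "x \<in> carr X"
  shows "h x \<in> carr Y"
    and "y \<in> carr X \<Longrightarrow> h (rop X x y) = rop Y (h x) (h y)"
    and "y \<in> carr X \<Longrightarrow> h (rinv X x y) = rinv Y (h x) (h y)"
  using assms by (auto simp: rack_hom_def)

lemma is_rack_fiber_product:
  assumes "is_rack X" "is_rack Y" "is_rack Z" "f \<in> rack_hom X Z" "g \<in> rack_hom Y Z"
  shows "is_rack (fiber_product X f Y g)"
  using assms unfolding is_rack_def[of "fiber_product X f Y g"]
  by (auto simp: fiber_product_def rack_closed rack_cancel rack_homD intro: rack_distrib)

lemma conn_sym: "(x, y) \<in> conn X \<Longrightarrow> (y, x) \<in> conn X"
  by (auto simp: conn_def intro: equivclp_sym)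

lemma conn_trans: "(x, y) \<in> conn X \<Longrightarrow> (y, z) \<in> conn X \<Longrightarrow> (x, z) \<in> conn X"
  by (auto simp: conn_def intro: equivclp_trans)

lemma conn_refl: "x \<in> carr X \<Longrightarrow> (x, x) \<in> conn X"
  by (auto simp: conn_def)

lemma conn_rop:
  assumes "is_rack X" "x \<in> carr X" "y \<in> carr X"
  shows "(x, rop X x y) \<in> conn X"
  using assms by (auto simp: conn_def rack_closed)

lemma conn_rinv:
  assumes "is_rack X" "x \<in> carr X" "y \<in> carr X"
  shows "(rinv X x y, x) \<in> conn X"
  using conn_rop[of X "rinv X x y" y] assms by (simp add: rack_closed rack_cancel)

lemma conn_invariant:
  assumes "(x, y) \<in> conn X"
    and step: "\<And>x y. x \<in> carr X \<Longrightarrow> y \<in> carr X \<Longrightarrow> I (rop X x y) = I x"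
  shows "I x = I y"
proof -
  have "equivclp (\<lambda>a b. a \<in> carr X \<and> (\<exists>c\<in>carr X. b = rop X a c)) x y"
    using assms(1) by (simp add: conn_def)
  then show ?thesis
    by (induction rule: equivclp_induct) (auto simp: step)
qed

lemma eta_eq_iff:
  assumes "x \<in> carr X" "y \<in> carr X"
  shows "eta X x = eta X y \<longleftrightarrow> (x, y) \<in> conn X"
  using assms equiv_conn[of X] by (simp add: eta_def eq_equiv_class_iff)

lemma eta_hom:
  assumes "is_rack X"
  shows "eta X \<in> rack_hom X (pi0 X)"
proof -
  have "eta X (rop X x y) = eta X x" "eta X (rinv X x y) = eta X x"
    if "x \<in> carr X" "y \<in> carr X" for x y
    using that assms conn_rop[of X x y] conn_rinv[of X x y]
    by (auto simp: eta_eq_iff rack_closed intro: conn_sym)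
  then show ?thesis
    by (auto simp: rack_hom_def pi0_def trivial_rack_def eta_def quotientI)
qed

text \<open>A step from \<open>h x\<close> acts by some element of \<open>Y\<close>, which comes from \<open>X\<close>.\<close>

lemma conn_lift:
  assumes h: "h \<in> rack_hom X Y" "h ` carr X = carr Y" and X: "is_rack X" and Y: "is_rack Y"
    and x: "x \<in> carr X" and xy: "(h x, y) \<in> conn Y"
  shows "\<exists>x'. (x, x') \<in> conn X \<and> h x' = y"
proof -
  let ?I = "\<lambda>v. \<exists>x'. (x, x') \<in> conn X \<and> h x' = v"
  have "?I (rop Y v w) = ?I v" if v: "v \<in> carr Y" and w: "w \<in> carr Y" for v w
  proof -
    obtain c where c: "c \<in> carr X" "h c = w" using w h by (metis imageE)
    have carr: "x' \<in> carr X" if "(x, x') \<in> conn X" for x' using that by (simp add: conn_def)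
    show ?thesis
    proof
      assume "?I v"
      then obtain x' where x': "(x, x') \<in> conn X" "h x' = v" by blast
      moreover have "(x, rop X x' c) \<in> conn X"
        using conn_trans[OF x'(1) conn_rop[OF X carr[OF x'(1)] c(1)]] .
      ultimately show "?I (rop Y v w)" using carr c rack_homD(2)[OF h(1)] by blast
    next
      assume "?I (rop Y v w)"
      then obtain x' where x': "(x, x') \<in> conn X" "h x' = rop Y v w" by blast
      moreover have "(x, rinv X x' c) \<in> conn X"
        using conn_trans[OF x'(1) conn_sym[OF conn_rinv[OF X carr[OF x'(1)] c(1)]]] .
      moreover have "h (rinv X x' c) = v"
        using x' carr c rack_homD(3)[OF h(1)] rack_cancel(1)[OF Y v w] by simp
      ultimately show "?I v" by blast
    qed
  qed
  from conn_invariant[where I = ?I, OF xy this] show ?thesis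
    using x conn_refl by fast
qed


section \<open>Trivial extensions and coverings\<close>

text \<open>Of the comparison map with the pullback, only injectivity is a condition: a point of the
  pullback is an element of \<open>Y\<close> together with a component of \<open>X\<close> over its component, and paths
  lift by \<open>conn_lift\<close>.\<close>

lemma trivial_extension_iff:
  assumes X: "is_rack (src t)" and Y: "is_rack (tgt t)" and t: "is_extension t"
  shows "trivial_extension t \<longleftrightarrow>
    (\<forall>x x'. (x, x') \<in> conn (src t) \<longrightarrow> fn t x = fn t x' \<longrightarrow> x = x')"
    (is "_ \<longleftrightarrow> ?inj")
proof -
  let ?X = "src t" and ?Y = "tgt t" and ?h = "fn t"
  let ?pi = "pi0_map ?X ?Y ?h"
  let ?c = "\<lambda>z. (?h z, eta ?X z)" and ?F = "fiber_product ?Y (eta ?Y) (pi0 ?X) ?pi"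
  have h: "?h \<in> rack_hom ?X ?Y" "?h ` carr ?X = carr ?Y"
    using t by (auto simp: is_extension_def)
  have square: "eta ?Y (?h z) = ?pi (eta ?X z)" if "z \<in> carr ?X" for z
    using pi0_map_eta[OF h(1) that] by simp
  have "?c ` carr ?X = carr ?F"
  proof (intro equalityI subsetI)
    fix v assume "v \<in> ?c ` carr ?X"
    then show "v \<in> carr ?F"
      using square rack_homD(1)[OF h(1)] rack_homD(1)[OF eta_hom[OF X]]
      by (auto simp: fiber_product_def)
  next
    fix v assume "v \<in> carr ?F"
    then obtain y x where v: "v = (y, eta ?X x)" "y \<in> carr ?Y" "x \<in> carr ?X"
        "eta ?Y y = ?pi (eta ?X x)"
      by (auto simp: fiber_product_def pi0_def trivial_rack_def eta_def elim!: quotientE)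
    then have "(?h x, y) \<in> conn ?Y"
      using square[of x] rack_homD(1)[OF h(1)] by (metis eta_eq_iff)
    from conn_lift[OF h X Y v(3) this] obtain x' where x': "(x, x') \<in> conn ?X" "?h x' = y"
      by blast
    then have "x' \<in> carr ?X" by (simp add: conn_def)
    moreover from this x' v have "v = ?c x'" by (simp add: eta_eq_iff)
    ultimately show "v \<in> ?c ` carr ?X" by blast
  qed
  then have "trivial_extension t \<longleftrightarrow> inj_on ?c (carr ?X)"
    using t h square eta_hom[OF X]
    by (auto simp: trivial_extension_def is_pullback_def bij_betw_def)
  also have "\<dots> \<longleftrightarrow> ?inj"
  proof
    assume "inj_on ?c (carr ?X)"
    then show ?inj by (auto simp: inj_on_def eta_eq_iff conn_def)
  next
    assume ?inj
    then show "inj_on ?c (carr ?X)" by (auto simp: inj_on_def eta_eq_iff)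
  qed
  finally show ?thesis .
qed

text \<open>For quandles these are the coverings of Eisermann.\<close>

definition covering :: "('a, 'b) rack_arrow \<Rightarrow> bool" where
  "covering f \<longleftrightarrow> is_extension f \<and>
     (\<forall>x\<in>carr (src f). \<forall>a\<in>carr (src f). \<forall>a'\<in>carr (src f).
        fn f a = fn f a' \<longrightarrow> rop (src f) x a = rop (src f) x a')"

lemma covering_rinv:
  assumes "covering f" "is_rack (src f)" "x \<in> carr (src f)" "a \<in> carr (src f)" "a' \<in> carr (src f)"
    and "fn f a = fn f a'"
  shows "rinv (src f) x a = rinv (src f) x a'"
proof -
  have "rop (src f) (rinv (src f) x a) a' = rop (src f) (rinv (src f) x a) a"
    using assms unfolding covering_def by (metis rack_closed(2))
  then show ?thesis using assms by (metis rack_cancel rack_closed(2))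
qed

lemma pullback_ext_rack:
  assumes "is_extension f" "is_extension e" "tgt e = tgt f"
    and "is_rack (src f)" "is_rack (tgt f)" "is_rack (src e)"
  shows "is_rack (src (pullback_ext f e))" "is_extension (pullback_ext f e)"
proof -
  let ?P = "fiber_product (src f) (fn f) (src e) (fn e)"
  show P: "is_rack (src (pullback_ext f e))"
    using assms
    by (auto simp: pullback_ext_def Let_def is_extension_def
        intro!: is_rack_fiber_product[where Z = "tgt f"])
  have "\<exists>a\<in>carr (src f). fn f a = fn e z" if "z \<in> carr (src e)" for z
    using assms that unfolding is_extension_def by (metis imageE imageI)
  then have "carr (src e) \<subseteq> snd ` carr ?P"
    by (force simp: fiber_product_def)
  moreover have "restrict snd (carr ?P) \<in> rack_hom ?P (src e)"
    unfolding rack_hom_def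
    using rack_closed[of ?P] P by (auto simp: pullback_ext_def) (auto simp: fiber_product_def)
  ultimately show "is_extension (pullback_ext f e)"
    by (auto simp: is_extension_def pullback_ext_def fiber_product_def)
qed

text \<open>If \<open>a\<close> and \<open>a'\<close> have the same image, then they can be paired with the same \<open>z\<close> in the
  pullback. The results of acting by \<open>(a, z)\<close> and \<open>(a', z)\<close> on any element of the pullback have
  the same second coordinate and lie in the same component, so they are equal.\<close>

lemma central_imp_covering:
  assumes "is_central (Rck U) f"
  shows "covering f"
proof -
  obtain e where e: "e \<in> obj (Ext (Rck U))" "tgt e = tgt f"
    and triv: "trivial_extension (pullback_ext f e)"
    using assms by (auto simp: is_central_def)
  have facts: "is_rack (src f)" "is_rack (tgt f)" "is_extension f" "is_rack (src e)" "is_extension e"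
    using assms e by (auto simp: is_central_def Ext_def Rck_def)
  let ?P = "src (pullback_ext f e)"
  have P: "is_rack ?P" "is_extension (pullback_ext f e)"
    by (rule pullback_ext_rack[OF facts(3,5) e(2) facts(1,2,4)])+
  have "is_rack (tgt (pullback_ext f e))" using facts by (simp add: pullback_ext_def Let_def)
  note inj = trivial_extension_iff[OF P(1) this P(2), THEN iffD1, OF triv, rule_format]
  show ?thesis unfolding covering_def
  proof (intro conjI ballI impI)
    show "is_extension f" using facts by simp
    fix x a a' assume x: "x \<in> carr (src f)" and a: "a \<in> carr (src f)" and a': "a' \<in> carr (src f)"
      and eq: "fn f a = fn f a'"
    have "\<exists>z\<in>carr (src e). fn e z = fn f v" if "v \<in> carr (src f)" for v
      using facts e(2) that unfolding is_extension_def by (metis imageE imageI)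
    then obtain z w where z: "z \<in> carr (src e)" "fn e z = fn f a"
      and w: "w \<in> carr (src e)" "fn e w = fn f x" using a x by meson
    have in_P: "(x, w) \<in> carr ?P" "(a, z) \<in> carr ?P" "(a', z) \<in> carr ?P"
      using x a a' z w eq by (auto simp: pullback_ext_def fiber_product_def)
    have "(rop ?P (x, w) (a, z), rop ?P (x, w) (a', z)) \<in> conn ?P"
      by (rule conn_trans[OF conn_sym]) (rule conn_rop[OF P(1) in_P(1)] in_P)+
    moreover have "rop ?P (x, w) (c, z) = (rop (src f) x c, rop (src e) w z)" for c
      by (simp add: pullback_ext_def fiber_product_def)
    moreover have "rop ?P (x, w) (c, z) \<in> carr ?P" if "(c, z) \<in> carr ?P" for c
      using rack_closed(1)[OF P(1) in_P(1) that] .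
    moreover have "fn (pullback_ext f e) p = snd p" if "p \<in> carr ?P" for p
      using that by (simp add: pullback_ext_def Let_def)
    ultimately have "(rop (src f) x a, rop (src e) w z) = (rop (src f) x a', rop (src e) w z)"
      using in_P by (metis inj snd_conv)
    then show "rop (src f) x a = rop (src f) x a'" by simp
  qed
qed

text \<open>For a lift \<open>h\<close> of \<open>e\<close> through \<open>f\<close>, the relation \<open>h z = a\<close> between \<open>a\<close> and \<open>z\<close> is invariant
  along components of the pullback: \<open>(b, w)\<close> acts on \<open>h z\<close> by \<open>h w\<close> and on \<open>a\<close> by \<open>b\<close>, and these
  act alike because they have the same image under the covering \<open>f\<close>. Hence \<open>a\<close> is determined by
  \<open>z\<close> and the component, if some lift takes the value \<open>a\<close> at \<open>z\<close>.\<close>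

lemma trivial_pullback_of_lifts:
  assumes f: "covering f" "is_rack (src f)" "is_rack (tgt f)"
    and e: "is_extension e" "is_rack (src e)" "tgt e = tgt f"
    and lifts: "\<And>a z. a \<in> carr (src f) \<Longrightarrow> z \<in> carr (src e) \<Longrightarrow> fn f a = fn e z \<Longrightarrow>
      \<exists>h\<in>rack_hom (src e) (src f). (\<forall>w\<in>carr (src e). fn f (h w) = fn e w) \<and> h z = a"
  shows "trivial_extension (pullback_ext f e)"
proof -
  let ?P = "src (pullback_ext f e)"
  have ext: "is_extension f" using f by (simp add: covering_def)
  note P = pullback_ext_rack[OF ext e(1,3) f(2,3) e(2)]
  have carr: "carr ?P = {(a, z). a \<in> carr (src f) \<and> z \<in> carr (src e) \<and> fn f a = fn e z}"
    by (simp add: pullback_ext_def fiber_product_def)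
  have "z = z'" if conn: "(z, z') \<in> conn ?P"
    and eq: "fn (pullback_ext f e) z = fn (pullback_ext f e) z'" for z z'
  proof -
    from conn have "z \<in> carr ?P" "z' \<in> carr ?P" by (auto simp: conn_def)
    with eq have "snd z = snd z'" by (simp add: pullback_ext_def Let_def)
    with \<open>z \<in> carr ?P\<close> \<open>z' \<in> carr ?P\<close> carr obtain a a' v where
      z: "z = (a, v)" "z' = (a', v)" "a \<in> carr (src f)" "v \<in> carr (src e)" "fn f a = fn e v"
      by (cases z; cases z') auto
    obtain h where h: "h \<in> rack_hom (src e) (src f)" "\<And>w. w \<in> carr (src e) \<Longrightarrow> fn f (h w) = fn e w"
      "h v = a" using lifts[OF z(3-5)] by blast
    let ?I = "\<lambda>(b, w). h w = b"
    have "?I (rop ?P p q) = ?I p" if pq: "p \<in> carr ?P" "q \<in> carr ?P" for p q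
    proof -
      obtain b w c u where bw: "p = (b, w)" "q = (c, u)" by (cases p; cases q)
      with pq carr have in_carr: "b \<in> carr (src f)" "w \<in> carr (src e)" "c \<in> carr (src f)"
        "u \<in> carr (src e)" "fn f c = fn e u" by auto
      have "h w \<in> carr (src f)" "h u \<in> carr (src f)"
        using in_carr rack_homD(1)[OF h(1)] by auto
      then have "rop (src f) (h w) (h u) = rop (src f) (h w) c"
        using f(1) in_carr h(2) unfolding covering_def by metis
      then have "h (rop (src e) w u) = rop (src f) (h w) c"
        using rack_homD(2)[OF h(1)] in_carr by simp
      moreover have "rop (src f) (h w) c = rop (src f) b c \<longleftrightarrow> h w = b"
        using rack_cancel(1)[OF f(2)] in_carr \<open>h w \<in> carr (src f)\<close> by metis
      ultimately show ?thesis by (simp add: bw pullback_ext_def fiber_product_def)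
    qed
    from conn_invariant[where I = ?I, OF conn this] have "?I z = ?I z'" by blast
    with h z show ?thesis by simp
  qed
  moreover have "is_rack (tgt (pullback_ext f e))" using e by (simp add: pullback_ext_def Let_def)
  ultimately show ?thesis using trivial_extension_iff P by blast
qed


section \<open>Small subsets closed under two operations\<close>

lemma lepoll_iff_card_of: "A \<lesssim> B \<longleftrightarrow> (card_of A, card_of B) \<in> ordLeq"
  by (simp add: lepoll_def card_of_ordLeq)

lemma Times_lepoll_infinite:
  assumes "infinite K" "A \<lesssim> K" "B \<lesssim> K"
  shows "A \<times> B \<lesssim> K"
proof -
  have "A \<times> B \<lesssim> K \<times> K" using assms by (simp add: times_lepoll_mono)
  also have "K \<times> K \<lesssim> K"
    using card_of_Times_same_infinite[OF assms(1)]
    by (simp add: lepoll_iff_card_of ordIso_iff_ordLeq)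
  finally show ?thesis .
qed

lemma UN_lepoll_infinite:
  assumes "infinite K" "I \<lesssim> K" "\<And>i. i \<in> I \<Longrightarrow> A i \<lesssim> K"
  shows "(\<Union>i\<in>I. A i) \<lesssim> K"
  using assms card_of_UNION_ordLeq_infinite[of K I A] by (auto simp: lepoll_iff_card_of)

lemma Un_lepoll_infinite:
  assumes "infinite K" "A \<lesssim> K" "B \<lesssim> K"
  shows "A \<union> B \<lesssim> K"
proof -
  have "(UNIV :: bool set) \<lesssim> K" by (rule finite_lepoll_infinite[OF assms(1)]) simp
  then have "(\<Union>i\<in>UNIV. if i then A else B) \<lesssim> K"
    using assms by (intro UN_lepoll_infinite) auto
  then show ?thesis by (simp add: UNIV_bool Un_commute)
qed

lemma small_closure:
  fixes S C :: "'a set"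
  assumes K: "infinite K" and S: "S \<lesssim> K" "S \<subseteq> C"
    and C: "\<And>x y. x \<in> C \<Longrightarrow> y \<in> C \<Longrightarrow> p x y \<in> C \<and> q x y \<in> C"
  obtains T where "S \<subseteq> T" "T \<subseteq> C" "T \<lesssim> K"
    "\<And>x y. x \<in> T \<Longrightarrow> y \<in> T \<Longrightarrow> p x y \<in> T \<and> q x y \<in> T"
proof -
  define G where "G A = A \<union> ((\<lambda>(x, y). p x y) ` (A \<times> A) \<union> (\<lambda>(x, y). q x y) ` (A \<times> A))" for A
  define T where "T n = (G ^^ n) S" for n
  have T_Suc: "T (Suc n) = G (T n)" for n by (simp add: T_def)
  have small: "T n \<lesssim> K" for n
  proof (induction n)
    case 0
    show ?case using S by (simp add: T_def)
  next
    case (Suc n)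
    have "f ` (T n \<times> T n) \<lesssim> K" for f :: "'a \<times> 'a \<Rightarrow> 'a"
      using image_lepoll Times_lepoll_infinite[OF K Suc Suc] by (rule lepoll_trans)
    then show ?case unfolding T_Suc G_def by (intro Un_lepoll_infinite K Suc)
  qed
  have sub: "T n \<subseteq> C" for n
    by (induction n) (use S C in \<open>auto simp: T_def G_def subset_iff\<close>)
  have mono: "T m \<subseteq> T n" if "m \<le> n" for m n
    using that by (rule lift_Suc_mono_le[rotated]) (auto simp: T_Suc G_def)
  show thesis
  proof (rule that[of "\<Union>n. T n"])
    have "S = T 0" by (simp add: T_def)
    then show "S \<subseteq> (\<Union>n. T n)" by blast
    show "(\<Union>n. T n) \<subseteq> C" using sub by blast
    show "(\<Union>n. T n) \<lesssim> K"
      using K small by (intro UN_lepoll_infinite) (auto simp: infinite_le_lepoll)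
    fix x y assume "x \<in> (\<Union>n. T n)" "y \<in> (\<Union>n. T n)"
    then obtain m n where "x \<in> T m" "y \<in> T n" by blast
    then have "x \<in> T (max m n)" "y \<in> T (max m n)"
      using mono[of m "max m n"] mono[of n "max m n"] by auto
    then have "p x y \<in> T (Suc (max m n)) \<and> q x y \<in> T (Suc (max m n))"
      by (auto simp: T_Suc G_def)
    then show "p x y \<in> (\<Union>n. T n) \<and> q x y \<in> (\<Union>n. T n)" by blast
  qed
qed


section \<open>Coverings of quandles are central\<close>

definition fibre :: "('a, 'b) rack_arrow \<Rightarrow> 'b \<Rightarrow> 'a set" where
  "fibre f b = {a \<in> carr (src f). fn f a = b}"

text \<open>The indices are the elements of the type of the domain only because there are enough of them
  to enumerate every fibre.\<close>

definition fibre_enumerations :: "('a, 'b) rack_arrow \<Rightarrow> ('a \<Rightarrow> 'a) set" where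
  "fibre_enumerations f = {\<phi>. \<exists>b\<in>carr (tgt f). range \<phi> = fibre f b}"

lemma fibre_enumerationsD:
  assumes "\<phi> \<in> fibre_enumerations f"
  shows "\<phi> i \<in> carr (src f)" "fn f (\<phi> i) = fn f (\<phi> j)" "range \<phi> = fibre f (fn f (\<phi> i))"
proof -
  obtain b where b: "range \<phi> = fibre f b" using assms by (auto simp: fibre_enumerations_def)
  then have "\<phi> k \<in> fibre f b" for k by blast
  with b show "\<phi> i \<in> carr (src f)" "fn f (\<phi> i) = fn f (\<phi> j)" "range \<phi> = fibre f (fn f (\<phi> i))"
    by (auto simp: fibre_def)
qed

text \<open>All values of an enumeration of a fibre of a covering act by the same bijection, which
  maps fibres onto fibres.\<close>

lemma fibre_enumerations_closed:
  assumes f: "covering f" "is_rack (src f)" "is_rack (tgt f)"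
    and \<phi>: "\<phi> \<in> fibre_enumerations f" and \<psi>: "\<psi> \<in> fibre_enumerations f"
  shows "(\<lambda>i. rop (src f) (\<phi> i) (\<psi> i)) \<in> fibre_enumerations f"
    and "(\<lambda>i. rinv (src f) (\<phi> i) (\<psi> i)) \<in> fibre_enumerations f"
proof -
  let ?A = "src f" and ?B = "tgt f"
  have hom: "fn f \<in> rack_hom ?A ?B" using f by (simp add: covering_def is_extension_def)
  note [simp] = rack_homD[OF hom] rack_closed[OF f(2)] rack_cancel[OF f(2)]
    rack_closed[OF f(3)] rack_cancel[OF f(3)]
  define a where "a = \<psi> undefined"
  have a [simp]: "a \<in> carr ?A" using fibre_enumerationsD(1)[OF \<psi>] by (simp add: a_def)
  obtain b where b: "b \<in> carr ?B" "range \<phi> = fibre f b"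
    using \<phi> by (auto simp: fibre_enumerations_def)
  have act: "rop ?A x (\<psi> i) = rop ?A x a" "rinv ?A x (\<psi> i) = rinv ?A x a" if "x \<in> carr ?A" for x i
    using f that fibre_enumerationsD(1,2)[OF \<psi>] covering_rinv[OF f(1,2)]
    unfolding a_def covering_def by blast+
  have "range (\<lambda>i. rop ?A (\<phi> i) (\<psi> i)) = (\<lambda>x. rop ?A x a) ` fibre f b"
    using b(2) act fibre_enumerationsD(1)[OF \<phi>] by (auto simp flip: b(2))
  also have "\<dots> = fibre f (rop ?B b (fn f a))"
  proof (intro equalityI subsetI)
    fix x assume "x \<in> fibre f (rop ?B b (fn f a))"
    then have "rinv ?A x a \<in> fibre f b" "x = rop ?A (rinv ?A x a) a"
      using b by (auto simp: fibre_def)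
    then show "x \<in> (\<lambda>x. rop ?A x a) ` fibre f b" by blast
  qed (auto simp: fibre_def)
  finally show "(\<lambda>i. rop ?A (\<phi> i) (\<psi> i)) \<in> fibre_enumerations f"
    using b by (auto simp: fibre_enumerations_def intro!: bexI[of _ "rop ?B b (fn f a)"])
  have "range (\<lambda>i. rinv ?A (\<phi> i) (\<psi> i)) = (\<lambda>x. rinv ?A x a) ` fibre f b"
    using b(2) act fibre_enumerationsD(1)[OF \<phi>] by (auto simp flip: b(2))
  also have "\<dots> = fibre f (rinv ?B b (fn f a))"
  proof (intro equalityI subsetI)
    fix x assume "x \<in> fibre f (rinv ?B b (fn f a))"
    then have "rop ?A x a \<in> fibre f b" "x = rinv ?A (rop ?A x a) a"
      using b by (auto simp: fibre_def)
    then show "x \<in> (\<lambda>x. rinv ?A x a) ` fibre f b" by blast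
  qed (auto simp: fibre_def)
  finally show "(\<lambda>i. rinv ?A (\<phi> i) (\<psi> i)) \<in> fibre_enumerations f"
    using b by (auto simp: fibre_enumerations_def intro!: bexI[of _ "rinv ?B b (fn f a)"])
qed

text \<open>The quandle \<open>E\<close> consists of enumerations of fibres, with pointwise operations, so that
  evaluation at each index is a lift of \<open>e\<close> through \<open>f\<close>, and every element of a fibre is a value of
  each enumeration of it. All enumerations together may be too many for \<open>E\<close> to be small. It is
  therefore generated by one enumeration for each element \<open>c\<close> of the domain of \<open>f\<close> (the identity
  on the fibre of \<open>c\<close> and constant elsewhere) and transported to the given type of elements.\<close>

lemma covering_imp_central:
  fixes f :: "('u, 'u) rack_arrow"
  assumes U: "smallness U" and f: "covering f" "src f \<in> Qnd U" "tgt f \<in> Qnd U"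
  shows "is_central (Qnd U) f"
proof -
  let ?A = "src f" and ?B = "tgt f"
  have racks: "is_rack ?A" "is_rack ?B" and idem: "\<And>x. x \<in> carr ?A \<Longrightarrow> rop ?A x x = x"
    and A: "carr ?A \<in> U" using f by (auto simp: Qnd_def is_quandle_def)
  have hom: "fn f \<in> rack_hom ?A ?B" and surj: "fn f ` carr ?A = carr ?B"
    using f by (auto simp: covering_def is_extension_def)
  have U_down: "Y \<in> U" if "X \<in> U" "Y \<lesssim> X" for X Y
    using U that unfolding smallness_def by blast
  obtain K where K: "K \<in> U" "infinite K" "carr ?A \<lesssim> K"
  proof (cases "finite (carr ?A)")
    case True
    with U that show thesis unfolding smallness_def by (meson finite_lepoll_infinite)
  next
    case False
    with A that show thesis by blast
  qed

  define gen where "gen c = (\<lambda>x. if x \<in> fibre f (fn f c) then x else c)" for c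
  have gen: "gen c \<in> fibre_enumerations f" if "c \<in> carr ?A" for c
    using that rack_homD(1)[OF hom that]
    by (auto simp: fibre_enumerations_def gen_def fibre_def intro!: bexI[of _ "fn f c"])
  have "gen ` carr ?A \<lesssim> K" using image_lepoll K(3) by (rule lepoll_trans)
  then obtain T where T: "gen ` carr ?A \<subseteq> T" "T \<subseteq> fibre_enumerations f" "T \<lesssim> K"
    and closed: "\<And>\<phi> \<psi>. \<phi> \<in> T \<Longrightarrow> \<psi> \<in> T \<Longrightarrow>
      (\<lambda>i. rop ?A (\<phi> i) (\<psi> i)) \<in> T \<and> (\<lambda>i. rinv ?A (\<phi> i) (\<psi> i)) \<in> T"
    by (rule small_closure[OF K(2), of "gen ` carr ?A" "fibre_enumerations f"
          "\<lambda>\<phi> \<psi> i. rop ?A (\<phi> i) (\<psi> i)" "\<lambda>\<phi> \<psi> i. rinv ?A (\<phi> i) (\<psi> i)"])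
      (use gen fibre_enumerations_closed[OF f(1) racks] in auto)
  obtain k where k: "inj_on k T" "k ` T \<subseteq> K" using T(3) by (auto simp: lepoll_def)
  define g where "g = inv_into T k"
  have g [simp]: "g (k \<phi>) = \<phi>" if "\<phi> \<in> T" for \<phi> using k that by (simp add: g_def)
  note [simp] = closed[THEN conjunct1] closed[THEN conjunct2]
  define E where "E = \<lparr>carr = k ` T, rop = (\<lambda>x y. k (\<lambda>i. rop ?A (g x i) (g y i))),
    rinv = (\<lambda>x y. k (\<lambda>i. rinv ?A (g x i) (g y i)))\<rparr>"
  define e :: "('u, 'u) rack_arrow"
    where "e = \<lparr>src = E, tgt = ?B, fn = (\<lambda>z\<in>k ` T. fn f (g z undefined))\<rparr>"
  have T_enum: "\<phi> \<in> fibre_enumerations f" if "\<phi> \<in> T" for \<phi> using T that by blast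
  have val: "\<phi> i \<in> carr ?A" if "\<phi> \<in> T" for \<phi> i
    using fibre_enumerationsD(1)[OF T_enum[OF that]] .
  have val_tgt: "fn f (\<phi> i) \<in> carr ?B" if "\<phi> \<in> T" for \<phi> i
    using rack_homD(1)[OF hom val[OF that]] .
  note [simp] = rack_closed[OF racks(1)] rack_cancel[OF racks(1)] idem rack_homD[OF hom]
  have ops: "rop E (k \<phi>) (k \<psi>) = k (\<lambda>i. rop ?A (\<phi> i) (\<psi> i))"
    "rinv E (k \<phi>) (k \<psi>) = k (\<lambda>i. rinv ?A (\<phi> i) (\<psi> i))" if "\<phi> \<in> T" "\<psi> \<in> T" for \<phi> \<psi>
    using that by (simp_all add: E_def)
  have carr_E: "carr E = k ` T" by (simp add: E_def)
  have quandle: "is_quandle E"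
    unfolding is_quandle_def is_rack_def carr_E ball_simps(9)
  proof (intro conjI ballI)
    fix \<phi> \<psi> \<chi> assume T': "\<phi> \<in> T" "\<psi> \<in> T" "\<chi> \<in> T"
    note [simp] = val[OF T'(1)] val[OF T'(2)] val[OF T'(3)] ops T'
    show "rop E (k \<phi>) (k \<psi>) \<in> k ` T" "rinv E (k \<phi>) (k \<psi>) \<in> k ` T" by simp_all
    show "rinv E (rop E (k \<phi>) (k \<psi>)) (k \<psi>) = k \<phi>" "rop E (rinv E (k \<phi>) (k \<psi>)) (k \<psi>) = k \<phi>"
      "rop E (k \<phi>) (k \<phi>) = k \<phi>" by simp_all
    show "rop E (rop E (k \<phi>) (k \<psi>)) (k \<chi>)
      = rop E (rop E (k \<phi>) (k \<chi>)) (rop E (k \<psi>) (k \<chi>))"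
      using rack_distrib[OF racks(1) val val val, OF T'] by simp
  qed
  then have E: "E \<in> Qnd U"
    using U_down[OF K(1)] k(2) by (simp add: Qnd_def E_def subset_imp_lepoll)
  have e_src_tgt: "src e = E" "tgt e = ?B" by (simp_all add: e_def)
  have fn_e: "fn e (k \<phi>) = fn f (\<phi> undefined)" if "\<phi> \<in> T" for \<phi>
    using that by (simp add: e_def)
  have e_ext: "is_extension e"
  proof -
    have "b \<in> (\<lambda>z. fn f (g z undefined)) ` k ` T" if b: "b \<in> carr ?B" for b
    proof -
      obtain c where c: "c \<in> carr ?A" "b = fn f c" using b[folded surj] by blast
      have "fn f (gen c undefined) = b" using c by (simp add: gen_def fibre_def)
      moreover have "gen c \<in> T" using T(1) c(1) by blast
      ultimately show ?thesis by (intro image_eqI[of _ _ "k (gen c)"]) simp_all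
    qed
    moreover have "fn e \<in> rack_hom E ?B"
      unfolding rack_hom_def carr_E ball_simps(9)
    proof (intro CollectI conjI ballI)
      show "fn e \<in> k ` T \<rightarrow>\<^sub>E carr ?B" by (intro PiE_I) (auto simp: e_def intro: val_tgt)
      fix \<phi> \<psi> assume T': "\<phi> \<in> T" "\<psi> \<in> T"
      note [simp] = val[OF T'(1)] val[OF T'(2)] ops T' fn_e
      show "fn e (rop E (k \<phi>) (k \<psi>)) = rop ?B (fn e (k \<phi>)) (fn e (k \<psi>))"
        "fn e (rinv E (k \<phi>) (k \<psi>)) = rinv ?B (fn e (k \<phi>)) (fn e (k \<psi>))" by simp_all
    qed
    moreover have "fn e ` k ` T = (\<lambda>z. fn f (g z undefined)) ` k ` T"
      by (simp add: e_def)
    moreover have "\<dots> \<subseteq> carr ?B" by (auto intro: val_tgt)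
    ultimately show ?thesis by (auto simp: is_extension_def e_src_tgt carr_E)
  qed
  have "trivial_extension (pullback_ext f e)"
  proof (rule trivial_pullback_of_lifts[OF f(1) racks e_ext])
    show "is_rack (src e)" "tgt e = tgt f" using quandle by (auto simp: e_src_tgt is_quandle_def)
    fix a z assume a: "a \<in> carr ?A" and z: "z \<in> carr (src e)" and eq: "fn f a = fn e z"
    obtain \<phi> where \<phi>: "\<phi> \<in> T" "z = k \<phi>" using z by (auto simp: e_src_tgt carr_E)
    have "a \<in> range \<phi>"
      using a eq \<phi> fibre_enumerationsD(3)[OF T_enum, of \<phi> undefined]
      by (simp add: fn_e fibre_def)
    then obtain i where i: "a = \<phi> i" by blast
    let ?h = "\<lambda>z\<in>k ` T. g z i"
    have "?h \<in> rack_hom (src e) ?A"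
      unfolding rack_hom_def e_src_tgt carr_E ball_simps(9)
    proof (intro CollectI conjI ballI)
      show "?h \<in> k ` T \<rightarrow>\<^sub>E carr ?A" by (intro PiE_I) (auto intro: val)
    qed (simp_all add: ops)
    moreover have "fn f (?h w) = fn e w" if "w \<in> carr (src e)" for w
    proof -
      from that obtain \<psi> where "\<psi> \<in> T" "w = k \<psi>" by (auto simp: e_src_tgt carr_E)
      then show ?thesis
        using fibre_enumerationsD(2)[OF T_enum, of \<psi> i undefined] by (simp add: fn_e)
    qed
    moreover have "?h z = a" using \<phi> i by simp
    ultimately show "\<exists>h\<in>rack_hom (src e) ?A. (\<forall>w\<in>carr (src e). fn f (h w) = fn e w) \<and> h z = a"
      by blast
  qed
  moreover have "f \<in> obj (Ext (Qnd U))" using f by (simp add: Ext_def covering_def)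
  moreover have "e \<in> obj (Ext (Qnd U))" "tgt e = tgt f"
    using f(3) E e_ext by (auto simp: Ext_def e_def)
  ultimately show ?thesis unfolding is_central_def by blast
qed

lemma obj_Ext_Qnd_subset: "obj (Ext (Qnd U)) \<subseteq> obj (Ext (Rck U))"
  using Qnd_subset_Rck[of U] by (auto simp: Ext_def)

lemma central_Qnd_imp_Rck: "is_central (Qnd U) f \<Longrightarrow> is_central (Rck U) f"
  using obj_Ext_Qnd_subset[of U] unfolding is_central_def by blast


section \<open>Reflections of quandle extensions\<close>

definition image_rack :: "'a rack \<Rightarrow> ('b \<Rightarrow> 'a) \<Rightarrow> 'b rack \<Rightarrow> 'a rack" where
  "image_rack Y h X = Y\<lparr>carr := h ` carr X\<rparr>"

lemma image_rack_quandle: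
  assumes h: "h \<in> rack_hom X Y" and X: "is_quandle X" and Y: "is_rack Y"
  shows "is_quandle (image_rack Y h X)" "h \<in> rack_hom X (image_rack Y h X)"
proof -
  have rack: "is_rack X" and idem: "\<And>x. x \<in> carr X \<Longrightarrow> rop X x x = x"
    using X by (auto simp: is_quandle_def)
  have closed: "rop Y (h x) (h y) \<in> h ` carr X" "rinv Y (h x) (h y) \<in> h ` carr X"
    if "x \<in> carr X" "y \<in> carr X" for x y
    using rack_closed[OF rack that] by (simp_all flip: rack_homD(2,3)[OF h that])
  have "rop Y (h x) (h x) = h x" if "x \<in> carr X" for x
    using rack_homD(2)[OF h that that] idem[OF that] by simp
  then show "is_quandle (image_rack Y h X)"
    using closed rack_homD(1)[OF h] unfolding is_quandle_def is_rack_def image_rack_def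
    by (auto simp: rack_cancel[OF Y] intro: rack_distrib[OF Y])
  show "h \<in> rack_hom X (image_rack Y h X)"
    using h by (auto simp: rack_hom_def image_rack_def)
qed

text \<open>The image \<open>m\<close> of the unit \<open>f \<rightarrow> F\<^sub>0 f\<close> is a covering of quandles, since it is a
  subextension of the covering \<open>F\<^sub>0 f\<close>. So it is central, and the unit, as a morphism \<open>f \<rightarrow> m\<close>,
  factors through the unit \<open>f \<rightarrow> F\<^sub>0 f\<close> by some \<open>v : F\<^sub>0 f \<rightarrow> m\<close>. Seen as an endomorphism of
  \<open>F\<^sub>0 f\<close>, \<open>v\<close> fixes the unit, so it is the identity. Since its values lie in \<open>m\<close>, the
  subextension \<open>m\<close> is all of \<open>F\<^sub>0 f\<close>.\<close>

lemma reflection_quandle: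
  assumes U: "smallness U" and R: "is_reflector (CExt (Rck U)) (Ext (Rck U)) F\<^sub>0 F\<^sub>1 u"
    and f: "f \<in> obj (Ext (Qnd U))"
  shows "is_central (Qnd U) (F\<^sub>0 f)"
proof -
  let ?C = "Ext (Rck U)" and ?D = "CExt (Rck U)"
  have fR: "f \<in> obj ?C" using f obj_Ext_Qnd_subset by blast
  define f' where "f' = F\<^sub>0 f"
  obtain s t where st: "u f = (s, t)" by (cases "u f")
  have f'D: "f' \<in> obj ?D" using R fR by (auto simp: is_reflector_def is_functor_def f'_def)
  then have central: "is_central (Rck U) f'" by (simp add: CExt_def)
  then have cov: "covering f'" and f'C: "f' \<in> obj ?C"
    using central_imp_covering by (auto simp: is_central_def)
  have racks: "is_rack (src f')" "is_rack (tgt f')"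
    and small: "carr (src f') \<in> U" "carr (tgt f') \<in> U"
    and hom': "fn f' \<in> rack_hom (src f') (tgt f')"
    using f'C by (auto simp: Ext_def Rck_def is_extension_def)
  have quandles: "is_quandle (src f)" "is_quandle (tgt f)"
    and hom: "fn f \<in> rack_hom (src f) (tgt f)" and surj: "fn f ` carr (src f) = carr (tgt f)"
    using f by (auto simp: Ext_def Qnd_def is_extension_def)
  have unit: "u f \<in> hom ?C f f'" using R fR by (simp add: is_reflector_def f'_def)
  then have s: "s \<in> rack_hom (src f) (src f')" and t: "t \<in> rack_hom (tgt f) (tgt f')"
    and square: "\<And>x. x \<in> carr (src f) \<Longrightarrow> fn f' (s x) = t (fn f x)"
    by (auto simp: Ext_def st)
  note S = image_rack_quandle[OF s quandles(1) racks(1)]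
    and Tm = image_rack_quandle[OF t quandles(2) racks(2)]
  define m :: "('a, 'a) rack_arrow" where "m = \<lparr>src = image_rack (src f') s (src f),
    tgt = image_rack (tgt f') t (tgt f), fn = restrict (fn f') (s ` carr (src f))\<rparr>"
  have carr_m: "carr (src m) = s ` carr (src f)" "carr (tgt m) = t ` carr (tgt f)"
    by (auto simp: m_def image_rack_def)
  have sub: "carr (src m) \<subseteq> carr (src f')" "carr (tgt m) \<subseteq> carr (tgt f')"
    using rack_homD(1)[OF s] rack_homD(1)[OF t] by (auto simp: carr_m)
  have ops: "rop (src m) = rop (src f')" "rinv (src m) = rinv (src f')"
    "rop (tgt m) = rop (tgt f')" "rinv (tgt m) = rinv (tgt f')"
    by (auto simp: m_def image_rack_def)
  have fn_m: "fn m x = fn f' x" if "x \<in> carr (src m)" for x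
    using that by (simp add: m_def image_rack_def)
  have "fn f' ` s ` carr (src f) = t ` fn f ` carr (src f)"
    using square by (simp add: image_image)
  then have image: "fn f' ` carr (src m) = carr (tgt m)" by (simp add: carr_m surj)
  have m_racks: "is_rack (src m)" "is_rack (tgt m)"
    using S Tm by (auto simp: m_def is_quandle_def)
  have "fn m \<in> carr (src m) \<rightarrow>\<^sub>E carr (tgt m)"
    using image by (auto simp: m_def image_rack_def)
  then have "fn m \<in> rack_hom (src m) (tgt m)"
    using rack_closed[OF m_racks(1)] hom' sub fn_m
    by (auto simp: rack_hom_def subset_iff) (auto simp: ops)
  then have "is_extension m" using image fn_m by (simp add: is_extension_def)
  then have "covering m"
    using cov sub fn_m unfolding covering_def ops by (metis subsetD)
  moreover have "carr (src m) \<in> U" "carr (tgt m) \<in> U"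
    using U small sub unfolding smallness_def by (meson subset_imp_lepoll)+
  then have m_Qnd: "src m \<in> Qnd U" "tgt m \<in> Qnd U"
    using S(1) Tm(1) by (auto simp: Qnd_def m_def)
  ultimately have "is_central (Qnd U) m" by (rule covering_imp_central[OF U])
  then have mD: "m \<in> obj ?D" by (simp add: CExt_def central_Qnd_imp_Rck)
  have "u f \<in> hom ?C f m"
    using S(2) Tm(2) square by (auto simp: Ext_def st m_def image_rack_def)
  then obtain v where v: "v \<in> hom ?D f' m" "cmp ?C f v (u f) = u f"
    using R fR mD unfolding is_reflector_def f'_def by blast
  have "v \<in> hom ?D f' f'"
  proof -
    obtain v1 v2 where v12: "v = (v1, v2)" by (cases v)
    then have "v1 \<in> rack_hom (src f') (src m)" "v2 \<in> rack_hom (tgt f') (tgt m)"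
      and sq: "\<forall>x\<in>carr (src f'). fn m (v1 x) = v2 (fn f' x)"
      using v(1) by (auto simp: CExt_def Ext_def)
    moreover from this have "\<forall>x\<in>carr (src f'). fn f' (v1 x) = v2 (fn f' x)"
      using fn_m rack_homD(1) by metis
    ultimately show ?thesis
      using sub by (auto simp: CExt_def Ext_def v12 rack_hom_def ops)
  qed
  moreover have "idm ?C f' \<in> hom ?D f' f'" "cmp ?C f (idm ?C f') (u f) = u f"
  proof -
    have "is_category ?C" by (rule is_category_Ext) (auto simp: Rck_def)
    then show "idm ?C f' \<in> hom ?D f' f'" "cmp ?C f (idm ?C f') (u f) = u f"
      using fR f'C unit unfolding is_category_def by (auto simp: CExt_def)
  qed
  moreover have "\<exists>!g. g \<in> hom ?D f' f' \<and> cmp ?C f g (u f) = u f"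
    using R fR f'D unit unfolding is_reflector_def f'_def by blast
  ultimately have "v = idm ?C f'" using v(2) by blast
  then have "(\<lambda>x\<in>carr (src f'). x) \<in> rack_hom (src f') (src m)"
    "(\<lambda>x\<in>carr (tgt f'). x) \<in> rack_hom (tgt f') (tgt m)"
    using v(1) by (auto simp: CExt_def Ext_def)
  then have "carr (src f') \<subseteq> carr (src m)" "carr (tgt f') \<subseteq> carr (tgt m)"
    by (auto simp: rack_hom_def PiE_iff)
  with sub have "carr (src f') = carr (src m)" "carr (tgt f') = carr (tgt m)" by auto
  then have "src f' = src m" "tgt f' = tgt m"
    using ops by (auto intro!: rack.equality)
  with m_Qnd cov show ?thesis unfolding f'_def[symmetric]
    by (intro covering_imp_central[OF U]) auto
qed

text \<open>Arrows, composition and identities are the same for quandles as for racks, so only the values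
  \<open>F\<^sub>0 f\<close> on objects have to be checked.\<close>

lemma reflector_restricts:
  assumes U: "smallness U" and R: "is_reflector (CExt (Rck U)) (Ext (Rck U)) F\<^sub>0 F\<^sub>1 u"
  shows "is_reflector (CExt (Qnd U)) (Ext (Qnd U)) F\<^sub>0 F\<^sub>1 u"
proof -
  have sub: "f \<in> obj (Ext (Rck U))" if "f \<in> obj (Ext (Qnd U))" for f
    using that obj_Ext_Qnd_subset by blast
  have subD: "d \<in> obj (CExt (Rck U))" if "d \<in> obj (CExt (Qnd U))" for d
    using that central_Qnd_imp_Rck by (simp add: CExt_def)
  have objD: "F\<^sub>0 f \<in> obj (CExt (Qnd U))" if "f \<in> obj (Ext (Qnd U))" for f
    using reflection_quandle[OF U R that] by (simp add: CExt_def)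
  have same: "hom (Ext (Qnd U)) = hom (Ext (Rck U))" "cmp (Ext (Qnd U)) = cmp (Ext (Rck U))"
    "idm (Ext (Qnd U)) = idm (Ext (Rck U))" "hom (CExt (Qnd U)) = hom (CExt (Rck U))"
    "cmp (CExt (Qnd U)) = cmp (CExt (Rck U))" "idm (CExt (Qnd U)) = idm (CExt (Rck U))"
    by (simp_all add: Ext_def CExt_def)
  show ?thesis
    using R full_subcategory_CExt[of "Qnd U"] sub subD objD
    unfolding is_reflector_def is_functor_def same by meson
qed

theorem corollary3p3p0p2:
  fixes U :: "'u set set"
  assumes "smallness U"
    and "reflective (CExt (Rck U)) (Ext (Rck U))"
  shows "reflective (CExt (Qnd U)) (Ext (Qnd U)) \<and>
    (\<forall>F\<^sub>0 F\<^sub>1 u. is_reflector (CExt (Rck U)) (Ext (Rck U)) F\<^sub>0 F\<^sub>1 u \<longrightarrow>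
               is_reflector (CExt (Qnd U)) (Ext (Qnd U)) F\<^sub>0 F\<^sub>1 u)"
  using assms reflector_restricts unfolding reflective_def by blast

end
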